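(* Let $X$ be a metric space. If $X$ has finite hyperbolic dimension, then $X$ has weak finite decomposition complexity. If $X$ has hyperbolic dimension at most $1$, then $X$ has (strong) finite decomposition complexity.
   Context: A metric family is a (countable) collection of metric spaces; a single metric space $X$ is viewed as the metric family $\{X\}$. Decomposition: Let $r>0$ and let $n$ be a non-negative integer. A metric family $\mathcal{X}$ is $(r,n)$-decomposable over a metric family $\mathcal{Y}$ if every $X\in\mathcal{X}$ can be written as $X=X_0\cup X_1\cup\cdots\cup X_n$ such that each $X_i$ is an $r$-disjoint union $X_i=\bigsqcup_j X_{ij}$ with each $X_{ij}$ in $\mathcal{Y}$ (subsets carry the subspace metric). Here $r$-disjoint means $d(U,V)>r$ for any two distinct members $U\neq V$ of the union. If $\mathfrak{C}$ is a collection of metric families, $\mathcal{X}$ is $n$-decomposable over $\mathfrak{C}$ if for every $r>0$ it is $(r,n)$-decomposable over some metric family $\mathcal{Y}$ in $\mathfrak{C}$. It is weakly decomposable over $\mathfrak{C}$ if it is $n$-decomposable over $\mathfrak{C}$ for some non-negative integer $n$, and strongly decomposable over $\mathfrak{C}$ if it is $1$-decomposable over $\mathfrak{C}$. A collection $\mathfrak{C}$ is closed under weak (resp. strong) decomposition if every metric family that is weakly (resp. strongly) decomposable over $\mathfrak{C}$ belongs to $\mathfrak{C}$. Finite decomposition complexity: A metric family $\mathcal{Z}$ is bounded if $\sup\{\operatorname{diam}(Z)\mid Z\in\mathcal{Z}\}<\infty$; $\mathfrak{B}$ denotes the collection of all bounded metric families. Let $\mathfrak{D}$ (resp. $w\mathfrak{D}$)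 be the smallest collection of metric families containing $\mathfrak{B}$ that is closed under strong (resp. weak) decomposition. A metric family in $\mathfrak{D}$ has (strong) finite decomposition complexity; a metric family in $w\mathfrak{D}$ has weak finite decomposition complexity. Hyperbolic dimension: Let $N$ be a positive integer and $R>0$. A subset $Y\subset X$ of a metric space $(X,d)$ is $(N,R)$-large scale doubling if for every $x\in X$ and every $r\ge R$, the intersection of $Y$ with the ball in $X$ of radius $2r$ centered at $x$ can be covered by $N$ balls of radius $r$ with centers in $X$. A metric family $\mathcal{Y}$ of subsets of $X$ is large scale doubling if there exists $(N,R)$ such that each $Y\in\mathcal{Y}$ is $(N,R)$-large scale doubling and every finite union of elements of $\mathcal{Y}$ is $(N,R')$-large scale doubling, where possibly $R'>R$ and $R'$ may depend on the particular finite union. Let $\mathfrak{L}$ be the collection of large scale doubling metric families. For a non-negative integer $n$, a metric space $X$ has hyperbolic dimension at most $n$ if $\{X\}$ is $n$-decomposable over $\mathfrak{L}$ (where the families used are families of subsets of $X$); the hyperbolic dimension of $X$ is the smallest such $n$, and is $\infty$ if no such $n$ exists. *)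

theory Defs
  imports "HOL-Analysis.Analysis"
begin

section \<open>Metric families\<close>

text \<open>
  Metric spaces are values of the library type \<^typ>\<open>'a metric\<close> (a carrier set with a distance
  function), and a metric family is a countable set of them. A subset \<open>S\<close> of \<open>X\<close> with the
  subspace metric is \<open>submetric X S\<close>. All families in one statement have points in one type \<open>'a\<close>;
  this loses nothing, since decomposition only ever produces subspaces. Values of \<^typ>\<open>'a metric\<close> also
  record the distance off the carrier; this is harmless because \<open>submetric X S\<close> keeps the distance
  function of \<open>X\<close>.
\<close>

definition metric_family :: "'a metric set \<Rightarrow> bool" where
  "metric_family \<X> \<longleftrightarrow> countable \<X>"

text \<open>
  Distances between sets and diameters are taken in \<^typ>\<open>ennreal\<close>, so that the distance to the
  empty set is \<open>\<infinity>\<close> and the diameter of the empty set is \<open>0\<close>.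
\<close>

definition set_distance :: "'a metric \<Rightarrow> 'a set \<Rightarrow> 'a set \<Rightarrow> ennreal" where
  "set_distance X U V = (INF u\<in>U. INF v\<in>V. ennreal (mdist X u v))"

definition diam :: "'a metric \<Rightarrow> ennreal" where
  "diam Z = (SUP x\<in>mspace Z. SUP y\<in>mspace Z. ennreal (mdist Z x y))"

definition bounded_families :: "'a metric set set" where
  "bounded_families = {\<Z>. metric_family \<Z> \<and> (SUP Z\<in>\<Z>. diam Z) < \<infinity>}"


section \<open>Decomposition\<close>

definition r_disjoint :: "'a metric \<Rightarrow> real \<Rightarrow> 'a set set \<Rightarrow> bool" where
  "r_disjoint X r \<U> \<longleftrightarrow> (\<forall>U\<in>\<U>. \<forall>V\<in>\<U>. U \<noteq> V \<longrightarrow> ennreal r < set_distance X U V)"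

definition r_disjoint_union_over :: "'a metric \<Rightarrow> real \<Rightarrow> 'a metric set \<Rightarrow> 'a set \<Rightarrow> bool" where
  "r_disjoint_union_over X r \<Y> A \<longleftrightarrow>
     (\<exists>\<U>. A = \<Union>\<U> \<and> r_disjoint X r \<U> \<and>
          (\<forall>U\<in>\<U>. U \<subseteq> mspace X \<and> submetric X U \<in> \<Y>))"

definition rn_decomposable :: "real \<Rightarrow> nat \<Rightarrow> 'a metric set \<Rightarrow> 'a metric set \<Rightarrow> bool" where
  "rn_decomposable r n \<X> \<Y> \<longleftrightarrow>
     (\<forall>X\<in>\<X>. \<exists>A :: nat \<Rightarrow> 'a set.
        mspace X = (\<Union>i\<le>n. A i) \<and> (\<forall>i\<le>n. r_disjoint_union_over X r \<Y> (A i)))"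

definition n_decomposable :: "nat \<Rightarrow> 'a metric set \<Rightarrow> 'a metric set set \<Rightarrow> bool" where
  "n_decomposable n \<X> \<CC> \<longleftrightarrow> (\<forall>r>0. \<exists>\<Y>\<in>\<CC>. rn_decomposable r n \<X> \<Y>)"

definition weakly_decomposable :: "'a metric set \<Rightarrow> 'a metric set set \<Rightarrow> bool" where
  "weakly_decomposable \<X> \<CC> \<longleftrightarrow> (\<exists>n. n_decomposable n \<X> \<CC>)"

definition strongly_decomposable :: "'a metric set \<Rightarrow> 'a metric set set \<Rightarrow> bool" where
  "strongly_decomposable \<X> \<CC> \<longleftrightarrow> n_decomposable 1 \<X> \<CC>"

definition closed_under_weak_decomposition :: "'a metric set set \<Rightarrow> bool" where
  "closed_under_weak_decomposition \<CC> \<longleftrightarrow>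
     (\<forall>\<X>. metric_family \<X> \<and> weakly_decomposable \<X> \<CC> \<longrightarrow> \<X> \<in> \<CC>)"

definition closed_under_strong_decomposition :: "'a metric set set \<Rightarrow> bool" where
  "closed_under_strong_decomposition \<CC> \<longleftrightarrow>
     (\<forall>\<X>. metric_family \<X> \<and> strongly_decomposable \<X> \<CC> \<longrightarrow> \<X> \<in> \<CC>)"


section \<open>Finite decomposition complexity\<close>

definition fdc_families :: "'a metric set set" where
  "fdc_families =
     \<Inter>{\<CC>. \<CC> \<subseteq> Collect metric_family \<and> bounded_families \<subseteq> \<CC> \<and>
         closed_under_strong_decomposition \<CC>}"

definition weak_fdc_families :: "'a metric set set" where
  "weak_fdc_families =
     \<Inter>{\<CC>. \<CC> \<subseteq> Collect metric_family \<and> bounded_families \<subseteq> \<CC> \<and>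
         closed_under_weak_decomposition \<CC>}"

definition has_fdc :: "'a metric \<Rightarrow> bool" where
  "has_fdc X \<longleftrightarrow> {X} \<in> fdc_families"

definition has_weak_fdc :: "'a metric \<Rightarrow> bool" where
  "has_weak_fdc X \<longleftrightarrow> {X} \<in> weak_fdc_families"


section \<open>Hyperbolic dimension\<close>

text \<open>
  Balls are open. With closed balls the constants \<open>(N, R)\<close> change (to \<open>(N\<^sup>2, 2 R)\<close>, say), but the
  large scale doubling families are the same.
\<close>

definition large_scale_doubling_subset :: "'a metric \<Rightarrow> nat \<Rightarrow> real \<Rightarrow> 'a set \<Rightarrow> bool" where
  "large_scale_doubling_subset X N R Y \<longleftrightarrow>
     (\<forall>x\<in>mspace X. \<forall>r\<ge>R. \<exists>C. C \<subseteq> mspace X \<and> finite C \<and> card C \<le> N \<and>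
        Y \<inter> mball_of X x (2 * r) \<subseteq> (\<Union>c\<in>C. mball_of X c r))"

definition large_scale_doubling :: "'a metric \<Rightarrow> 'a set set \<Rightarrow> bool" where
  "large_scale_doubling X \<Y> \<longleftrightarrow>
     (\<exists>N>0. \<exists>R>0.
        (\<forall>Y\<in>\<Y>. large_scale_doubling_subset X N R Y) \<and>
        (\<forall>\<F>. finite \<F> \<and> \<F> \<subseteq> \<Y> \<longrightarrow> (\<exists>R'>0. large_scale_doubling_subset X N R' (\<Union>\<F>))))"

text \<open>
  Large scale doubling refers to the ambient space (the balls are centred in \<open>X\<close>), so the
  collection of large scale doubling families is indexed by \<open>X\<close>.
\<close>

definition large_scale_doubling_families :: "'a metric \<Rightarrow> 'a metric set set" where
  "large_scale_doubling_families X =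
     {submetric X ` \<Y> | \<Y>. metric_family (submetric X ` \<Y>) \<and>
        \<Y> \<subseteq> Pow (mspace X) \<and> large_scale_doubling X \<Y>}"

definition hyperbolic_dim_at_most :: "'a metric \<Rightarrow> nat \<Rightarrow> bool" where
  "hyperbolic_dim_at_most X n \<longleftrightarrow> n_decomposable n {X} (large_scale_doubling_families X)"

definition hyperbolic_dim :: "'a metric \<Rightarrow> enat" where
  "hyperbolic_dim X = Inf {enat n | n. hyperbolic_dim_at_most X n}"


section \<open>Coherence of the definitions\<close>

lemma rn_decomposable_mono:
  assumes "rn_decomposable r m \<X> \<Y>" "m \<le> n"
  shows "rn_decomposable r n \<X> \<Y>"
  unfolding rn_decomposable_def
proof
  fix X assume "X \<in> \<X>"
  then obtain A :: "nat \<Rightarrow> 'a set" where A: "mspace X = (\<Union>i\<le>m. A i)"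
      "\<forall>i\<le>m. r_disjoint_union_over X r \<Y> (A i)"
    using assms(1) unfolding rn_decomposable_def by blast
  define B where "B i = (if i \<le> m then A i else {})" for i
  have "mspace X = (\<Union>i\<le>n. B i)"
    using A(1) assms(2) unfolding B_def by (auto split: if_splits) force
  moreover have "r_disjoint_union_over X r \<Y> {}"
    unfolding r_disjoint_union_over_def r_disjoint_def by (rule exI[of _ "{}"]) auto
  then have "\<forall>i\<le>n. r_disjoint_union_over X r \<Y> (B i)"
    using A(2) unfolding B_def by auto
  ultimately show "\<exists>A. mspace X = (\<Union>i\<le>n. A i) \<and> (\<forall>i\<le>n. r_disjoint_union_over X r \<Y> (A i))"
    by blast
qed

lemma hyperbolic_dim_at_most_mono:
  "hyperbolic_dim_at_most X m \<Longrightarrow> m \<le> n \<Longrightarrow> hyperbolic_dim_at_most X n"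
  unfolding hyperbolic_dim_at_most_def n_decomposable_def by (meson rn_decomposable_mono)

lemma hyperbolic_dim_le_iff: "hyperbolic_dim X \<le> enat n \<longleftrightarrow> hyperbolic_dim_at_most X n"
proof
  assume le: "hyperbolic_dim X \<le> enat n"
  let ?S = "{enat n | n. hyperbolic_dim_at_most X n}"
  have "?S \<noteq> {}"
  proof
    assume "?S = {}"
    then have "hyperbolic_dim X = \<infinity>"
      unfolding hyperbolic_dim_def by (metis Inf_empty top_enat_def)
    then show False using le by simp
  qed
  then have "hyperbolic_dim X \<in> ?S"
    unfolding hyperbolic_dim_def by (metis (mono_tags) Inf_enat_def LeastI ex_in_conv)
  then show "hyperbolic_dim_at_most X n"
    using le hyperbolic_dim_at_most_mono by fastforce
next
  assume "hyperbolic_dim_at_most X n"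
  then show "hyperbolic_dim X \<le> enat n"
    unfolding hyperbolic_dim_def by (intro Inf_lower) blast
qed

lemma n_decomposable_mono: "n_decomposable n \<X> \<CC> \<Longrightarrow> \<CC> \<subseteq> \<CC>' \<Longrightarrow> n_decomposable n \<X> \<CC>'"
  unfolding n_decomposable_def by blast

lemma bounded_families_fdc: "bounded_families \<subseteq> fdc_families"
  unfolding fdc_families_def by blast

lemma fdc_families_least:
  assumes "\<CC> \<subseteq> Collect metric_family" "bounded_families \<subseteq> \<CC>"
    "closed_under_strong_decomposition \<CC>"
  shows "fdc_families \<subseteq> \<CC>"
  using assms unfolding fdc_families_def by blast

lemma fdc_families_closed:
  "closed_under_strong_decomposition (fdc_families :: 'a metric set set)"
  unfolding closed_under_strong_decomposition_def
proof (intro allI impI)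
  fix \<X> :: "'a metric set"
  assume \<X>: "metric_family \<X> \<and> strongly_decomposable \<X> fdc_families"
  have "\<X> \<in> \<CC>" if \<CC>: "\<CC> \<subseteq> Collect metric_family" "bounded_families \<subseteq> \<CC>"
    "closed_under_strong_decomposition \<CC>" for \<CC>
  proof -
    have "strongly_decomposable \<X> \<CC>"
      using \<X> n_decomposable_mono[OF _ fdc_families_least[OF \<CC>]]
      unfolding strongly_decomposable_def by blast
    then show ?thesis
      using \<X> \<CC>(3) unfolding closed_under_strong_decomposition_def by blast
  qed
  then show "\<X> \<in> fdc_families"
    unfolding fdc_families_def by blast
qed

lemma bounded_families_weak_fdc: "bounded_families \<subseteq> weak_fdc_families"
  unfolding weak_fdc_families_def by blast

lemma weak_fdc_families_least:
  assumes "\<CC> \<subseteq> Collect metric_family" "bounded_families \<subseteq> \<CC>"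
    "closed_under_weak_decomposition \<CC>"
  shows "weak_fdc_families \<subseteq> \<CC>"
  using assms unfolding weak_fdc_families_def by blast

lemma weak_fdc_families_closed:
  "closed_under_weak_decomposition (weak_fdc_families :: 'a metric set set)"
  unfolding closed_under_weak_decomposition_def
proof (intro allI impI)
  fix \<X> :: "'a metric set"
  assume \<X>: "metric_family \<X> \<and> weakly_decomposable \<X> weak_fdc_families"
  have "\<X> \<in> \<CC>" if \<CC>: "\<CC> \<subseteq> Collect metric_family" "bounded_families \<subseteq> \<CC>"
    "closed_under_weak_decomposition \<CC>" for \<CC>
  proof -
    have "weakly_decomposable \<X> \<CC>"
      using \<X> n_decomposable_mono[OF _ weak_fdc_families_least[OF \<CC>]]
      unfolding weakly_decomposable_def by blast
    then show ?thesis
      using \<X> \<CC>(3) unfolding closed_under_weak_decomposition_def by blast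
  qed
  then show "\<X> \<in> weak_fdc_families"
    unfolding weak_fdc_families_def by blast
qed

lemma fdc_families_metric_family: "fdc_families \<subseteq> Collect metric_family"
  by (rule fdc_families_least)
     (auto simp: bounded_families_def closed_under_strong_decomposition_def)

lemma weak_fdc_families_metric_family: "weak_fdc_families \<subseteq> Collect metric_family"
  by (rule weak_fdc_families_least)
     (auto simp: bounded_families_def closed_under_weak_decomposition_def)

end

theory Submission
  imports Defs
begin

text \<open>
  A large scale doubling family has finite asymptotic dimension: at each scale \<open>r\<close> its members
  are covered by a fixed number of colours, each colour an \<open>r\<close>-disjoint union of uniformly bounded
  sets (\<open>doubling_coloured_cover\<close>). Finite asymptotic dimension in turn implies strong finite
  decomposition complexity, however many colours there are (\<open>finite_asymptotic_dimension_fdc\<close>).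
  Hence all large scale doubling families lie in \<open>fdc_families\<close>, and so in \<open>weak_fdc_families\<close>, and a
  space of hyperbolic dimension at most \<open>n\<close> is \<open>n\<close>-decomposable over them. Closure under weak
  decomposition gives the first claim, and closure under strong decomposition, with \<open>n = 1\<close>, the second.

  The substance is the second implication, which has to trade many colours at one scale for many rounds
  with two pieces each. For a fixed colour take covers at rapidly growing scales and merge
  their members so that boundaries stay apart: two points at distance at most \<open>k\<close> are separated by at
  most one set among those of level at least \<open>k\<close> (\<open>separated_layers.cores_sparse\<close>). Cut the space into the
  atoms of the sets of level at least \<open>L\<close>. Nearby points in different atoms differ in
  membership of exactly one set, so colouring an atom by the parity of the number of sets containing
  it makes atoms of equal parity far apart (\<open>cut_along_sparse_family\<close>). These numbers may be infinite, but
  only parities of differences matter, and a parity function exists on all subsets of any type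
  (\<open>parity_colouring\<close>). That is one strong decomposition, and afterwards each piece lies inside or outside every
  set of that colour at level \<open>L\<close> or above. After one such round for each colour, take a level beyond all the
  cuts: every point of a piece is covered by some set of that level, whose colour was cut, so the
  set contains the whole piece and bounds its diameter (\<open>multiscale_systems_fdc\<close>).
\<close>

section \<open>Real-valued criteria for boundedness and disjointness\<close>

lemma r_disjointI:
  assumes "0 \<le> r" "r < s"
    and "\<And>U V x y. U \<in> \<U> \<Longrightarrow> V \<in> \<U> \<Longrightarrow> U \<noteq> V \<Longrightarrow> x \<in> U \<Longrightarrow> y \<in> V \<Longrightarrow> s \<le> mdist X x y"
  shows "r_disjoint X r \<U>"
  unfolding r_disjoint_def
proof (intro ballI impI)
  fix U V assume *: "U \<in> \<U>" "V \<in> \<U>" "U \<noteq> V"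
  have "ennreal r < ennreal s"
    using assms(1,2) by (simp add: ennreal_less_iff)
  also have "ennreal s \<le> set_distance X U V"
    unfolding set_distance_def using assms(3) * by (intro INF_greatest ennreal_leI) blast
  finally show "ennreal r < set_distance X U V" .
qed

lemma bounded_familiesI:
  assumes "countable \<Z>"
    and "\<And>Z x y. Z \<in> \<Z> \<Longrightarrow> x \<in> mspace Z \<Longrightarrow> y \<in> mspace Z \<Longrightarrow> mdist Z x y \<le> B"
  shows "\<Z> \<in> bounded_families"
proof -
  have "(SUP Z\<in>\<Z>. diam Z) \<le> ennreal B"
    unfolding diam_def using assms(2) by (intro SUP_least ennreal_leI) auto
  then show ?thesis
    using assms(1) unfolding bounded_families_def metric_family_def by (simp add: le_less_trans)
qed

lemma mdist_self: "x \<in> mspace Z \<Longrightarrow> mdist Z x x = 0"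
  by simp

lemma mdist_triangle3:
  assumes "x \<in> mspace Z" "a \<in> mspace Z" "b \<in> mspace Z" "y \<in> mspace Z"
  shows "mdist Z x y \<le> mdist Z x a + mdist Z a b + mdist Z b y"
  using mdist_triangle[of x Z b y] mdist_triangle[of x Z a b] assms by linarith

section \<open>Cutting along one sparse family of sets\<close>

text \<open>
  The index \<open>k\<close> of \<open>\<U> k\<close> is both the level of its members and the width of the zone around
  their boundaries that no boundary of an equal or higher level enters.
\<close>

definition sparse_boundaries :: "'a metric \<Rightarrow> (nat \<Rightarrow> 'a set set) \<Rightarrow> bool" where
  "sparse_boundaries Z \<U> \<longleftrightarrow>
     (\<forall>k l. \<forall>S\<in>\<U> k. \<forall>T\<in>\<U> l. \<forall>x\<in>mspace Z. \<forall>y\<in>mspace Z.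
        mdist Z x y \<le> real (min k l) \<longrightarrow> (x \<in> S) \<noteq> (y \<in> S) \<longrightarrow> (x \<in> T) \<noteq> (y \<in> T) \<longrightarrow> S = T)"

text \<open>
  The invariant of the decomposition game: \<open>m\<close> colours are left and cuts have been made at levels
  up to \<open>K\<close>. The sets of level \<open>k\<close> need to cover \<open>Z\<close> only if \<open>Z\<close> is not already bounded by \<open>D k\<close>. This
  alternative accounts for the colours used up: it holds as soon as a set of level \<open>k\<close> and a used
  colour contains all of \<open>Z\<close>.
\<close>

definition multiscale_system ::
    "nat \<Rightarrow> nat \<Rightarrow> (nat \<Rightarrow> real) \<Rightarrow> 'a metric \<Rightarrow> (nat \<Rightarrow> nat \<Rightarrow> 'a set set) \<Rightarrow> bool" where
  "multiscale_system m K D Z \<U> \<longleftrightarrow>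
     (\<forall>i<m. sparse_boundaries Z (\<U> i)) \<and>
     (\<forall>i<m. \<forall>k. \<forall>S\<in>\<U> i k. \<forall>x\<in>S \<inter> mspace Z. \<forall>y\<in>S \<inter> mspace Z. mdist Z x y \<le> D k) \<and>
     (\<forall>k\<ge>K. (\<forall>x\<in>mspace Z. \<forall>y\<in>mspace Z. mdist Z x y \<le> D k) \<or>
             mspace Z \<subseteq> (\<Union>i<m. \<Union>(\<U> i k)))"

lemma multiscale_systemD:
  assumes "multiscale_system m K D Z \<U>"
  shows "i < m \<Longrightarrow> sparse_boundaries Z (\<U> i)"
    and "i < m \<Longrightarrow> S \<in> \<U> i k \<Longrightarrow> x \<in> S \<Longrightarrow> y \<in> S \<Longrightarrow> x \<in> mspace Z \<Longrightarrow> y \<in> mspace Z \<Longrightarrow> mdist Z x y \<le> D k"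
    and "K \<le> k \<Longrightarrow> (\<forall>x\<in>mspace Z. \<forall>y\<in>mspace Z. mdist Z x y \<le> D k) \<or>
             mspace Z \<subseteq> (\<Union>i<m. \<Union>(\<U> i k))"
  using assms unfolding multiscale_system_def by auto

lemma multiscale_systemI:
  assumes "\<And>i. i < m \<Longrightarrow> sparse_boundaries Z (\<U> i)"
    and "\<And>i k S x y. i < m \<Longrightarrow> S \<in> \<U> i k \<Longrightarrow> x \<in> S \<Longrightarrow> y \<in> S \<Longrightarrow> x \<in> mspace Z \<Longrightarrow> y \<in> mspace Z
            \<Longrightarrow> mdist Z x y \<le> D k"
    and "\<And>k. K \<le> k \<Longrightarrow> (\<forall>x\<in>mspace Z. \<forall>y\<in>mspace Z. mdist Z x y \<le> D k) \<or>
             mspace Z \<subseteq> (\<Union>i<m. \<Union>(\<U> i k))"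
  shows "multiscale_system m K D Z \<U>"
  using assms unfolding multiscale_system_def by auto

text \<open>
  For finite sets the parity of the cardinality is such a colouring. In general, compare \<open>A\<close> with a chosen
  representative of the class of sets that differ from \<open>A\<close> in finitely many elements.
\<close>

lemma parity_colouring:
  obtains c :: "'b set \<Rightarrow> bool" where "\<forall>A a. a \<notin> A \<longrightarrow> c (insert a A) \<noteq> c A"
proof -
  define rep :: "'b set \<Rightarrow> 'b set" where "rep A = (SOME B. finite (sym_diff A B))" for A
  define c where "c A = even (card (sym_diff A (rep A)))" for A
  have "c (insert a A) \<noteq> c A" if "a \<notin> A" for a A
  proof -
    have fin: "finite (sym_diff (insert a A) B) \<longleftrightarrow> finite (sym_diff A B)" for B
    proof -
      have "sym_diff (insert a A) B \<subseteq> insert a (sym_diff A B)"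
        "sym_diff A B \<subseteq> insert a (sym_diff (insert a A) B)" by auto
      then show ?thesis by (meson finite_insert finite_subset)
    qed
    then have rep: "rep (insert a A) = rep A"
      unfolding rep_def by simp
    have "finite (sym_diff A (rep A))"
      unfolding rep_def by (rule someI[of _ A]) simp
    moreover have "a \<in> rep A \<Longrightarrow> sym_diff A (rep A) = insert a (sym_diff (insert a A) (rep A))"
      "a \<notin> rep A \<Longrightarrow> sym_diff (insert a A) (rep A) = insert a (sym_diff A (rep A))"
      using that by auto
    moreover have "a \<in> rep A \<Longrightarrow> a \<notin> sym_diff (insert a A) (rep A)"
      "a \<notin> rep A \<Longrightarrow> a \<notin> sym_diff A (rep A)"
      using that by auto
    ultimately have "card (sym_diff A (rep A)) = Suc (card (sym_diff (insert a A) (rep A))) \<or>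
        card (sym_diff (insert a A) (rep A)) = Suc (card (sym_diff A (rep A)))"
      using fin[of "rep A"] by (metis card_insert_disjoint)
    then show ?thesis
      unfolding c_def rep by (metis even_Suc)
  qed
  then show thesis by (intro that[of c]) simp
qed

lemma multiscale_system_subspace:
  assumes sys: "multiscale_system m K D Z \<U>" and "K \<le> L"
  shows "multiscale_system m L D (submetric Z P) \<U>"
proof (rule multiscale_systemI)
  show "sparse_boundaries (submetric Z P) (\<U> i)" if "i < m" for i
    using multiscale_systemD(1)[OF sys that]
    unfolding sparse_boundaries_def mspace_submetric mdist_submetric by (meson IntD2)
next
  fix k assume "L \<le> k"
  then have "K \<le> k" using \<open>K \<le> L\<close> by simp
  from multiscale_systemD(3)[OF sys this]
  show "(\<forall>x\<in>mspace (submetric Z P). \<forall>y\<in>mspace (submetric Z P). mdist (submetric Z P) x y \<le> D k) \<or>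
      mspace (submetric Z P) \<subseteq> (\<Union>i<m. \<Union>(\<U> i k))"
    unfolding mspace_submetric mdist_submetric by blast
next
  show "mdist (submetric Z P) x y \<le> D k"
    if "i < m" "S \<in> \<U> i k" "x \<in> S" "y \<in> S"
      "x \<in> mspace (submetric Z P)" "y \<in> mspace (submetric Z P)" for i k S x y
    using multiscale_systemD(2)[OF sys that(1-4)] that(5,6) by simp
qed

text \<open>
  A strong decomposition, with the two unions of pieces indexed by \<open>bool\<close>. Empty pieces are excluded so
  that pieces can be counted by choosing a point in each.
\<close>

definition two_coloured_cover :: "real \<Rightarrow> 'a metric \<Rightarrow> (bool \<Rightarrow> 'a set set) \<Rightarrow> bool" where
  "two_coloured_cover s Z \<P> \<longleftrightarrow>
     mspace Z = (\<Union>b. \<Union>(\<P> b)) \<and> (\<forall>b. {} \<notin> \<P> b) \<and>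
     (\<forall>b. \<forall>P\<in>\<P> b. \<forall>Q\<in>\<P> b. P \<noteq> Q \<longrightarrow> (\<forall>x\<in>P. \<forall>y\<in>Q. s < mdist Z x y))"

text \<open>
  The pieces are the atoms of the sets of colour \<open>m\<close> and level at least \<open>L\<close>. At distance at most \<open>L\<close>
  at most one such set separates two points, so distinct atoms that close have different
  parity. For \<open>k\<close> beyond the cut, an atom that meets a set of level \<open>k\<close> and colour \<open>m\<close> lies inside it
  and is bounded; otherwise the remaining colours cover it at level \<open>k\<close>.
\<close>

lemma cut_along_sparse_family:
  assumes sys: "multiscale_system (Suc m) K D Z \<U>"
  shows "\<exists>\<P>. two_coloured_cover (real L) Z \<P> \<and>
           (\<forall>b. \<forall>P\<in>\<P> b. multiscale_system m (max K L) D (submetric Z P) \<U>)"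
proof -
  obtain c :: "'a set set \<Rightarrow> bool" where c: "\<forall>A a. a \<notin> A \<longrightarrow> c (insert a A) \<noteq> c A"
    by (rule parity_colouring)
  define containing where "containing x = {S. \<exists>k\<ge>L. S \<in> \<U> m k \<and> x \<in> S}" for x
  define \<P> where "\<P> b = (\<lambda>x. {y \<in> mspace Z. containing y = containing x}) ` {x \<in> mspace Z. c (containing x) = b}" for b
  have close: "containing x = containing y"
    if xy: "x \<in> mspace Z" "y \<in> mspace Z" "mdist Z x y \<le> real L" "c (containing x) = c (containing y)" for x y
  proof -
    have *: False
      if uv: "u \<in> mspace Z" "v \<in> mspace Z" "mdist Z u v \<le> real L" "c (containing u) = c (containing v)"
        and S: "S \<in> containing u" "S \<notin> containing v" for u v S
    proof -
      obtain k where k: "k \<ge> L" "S \<in> \<U> m k" "u \<in> S" "v \<notin> S"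
        using S unfolding containing_def by blast
      have "T = S" if T: "(T \<in> containing u) \<noteq> (T \<in> containing v)" for T
      proof -
        obtain l where l: "l \<ge> L" "T \<in> \<U> m l" "(u \<in> T) \<noteq> (v \<in> T)"
          using T unfolding containing_def by blast
        have "mdist Z u v \<le> real (min l k)"
          using uv(3) k(1) l(1) by linarith
        moreover have "sparse_boundaries Z (\<U> m)"
          using multiscale_systemD(1)[OF sys] by simp
        ultimately show ?thesis
          using uv(1,2) k(2-4) l(2,3) unfolding sparse_boundaries_def by metis
      qed
      then have "containing u = insert S (containing v)"
        using S by blast
      then show False
        using c S(2) uv(4) by metis
    qed
    show ?thesis
      using *[of x y] *[of y x] xy by (auto simp: mdist_commute)
  qed
  have "mspace Z = (\<Union>b. \<Union>(\<P> b))"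
    unfolding \<P>_def by auto
  moreover have "real L < mdist Z x y"
    if "P \<in> \<P> b" "Q \<in> \<P> b" "P \<noteq> Q" "x \<in> P" "y \<in> Q" for b P Q x y
  proof (rule ccontr)
    assume near: "\<not> real L < mdist Z x y"
    obtain p where p: "c (containing p) = b" "P = {y \<in> mspace Z. containing y = containing p}"
      using \<open>P \<in> \<P> b\<close> unfolding \<P>_def by blast
    obtain q where q: "c (containing q) = b" "Q = {y \<in> mspace Z. containing y = containing q}"
      using \<open>Q \<in> \<P> b\<close> unfolding \<P>_def by blast
    have x: "x \<in> mspace Z" "containing x = containing p" and y: "y \<in> mspace Z" "containing y = containing q"
      using that p q by auto
    have "containing x = containing y"
      using near p(1) q(1) by (intro close) (simp_all add: x y)
    then show False
      using \<open>P \<noteq> Q\<close> p(2) q(2) x(2) y(2) by simp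
  qed
  moreover have "P \<noteq> {} \<and> multiscale_system m (max K L) D (submetric Z P) \<U>"
    if P: "P \<in> \<P> b" for b P
  proof -
    obtain p where p: "p \<in> mspace Z" "P = {y \<in> mspace Z. containing y = containing p}"
      using P unfolding \<P>_def by blast
    have sub: "multiscale_system (Suc m) (max K L) D (submetric Z P) \<U>"
      using sys by (rule multiscale_system_subspace) simp
    have PZ: "P \<inter> mspace Z = P" using p by auto
    have alt: "(\<forall>x\<in>P. \<forall>y\<in>P. mdist Z x y \<le> D k) \<or> P \<subseteq> (\<Union>i<m. \<Union>(\<U> i k))"
      if k: "k \<ge> max K L" for k
    proof (cases "\<exists>S\<in>\<U> m k. p \<in> S")
      case True
      then obtain S where S: "S \<in> \<U> m k" "p \<in> S" by blast
      then have "S \<in> containing p" using k unfolding containing_def by auto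
      then have "P \<subseteq> S" using p unfolding containing_def by blast
      then have "\<forall>x\<in>P. \<forall>y\<in>P. mdist Z x y \<le> D k"
        using multiscale_systemD(2)[OF sys _ S(1)] p(2) by blast
      then show ?thesis ..
    next
      case False
      have "y \<notin> S" if "S \<in> \<U> m k" "y \<in> P" for S y
      proof
        assume "y \<in> S"
        then have "S \<in> containing y" using that k unfolding containing_def by auto
        then have "p \<in> S" using that p unfolding containing_def by auto
        then show False using False that by blast
      qed
      moreover have "(\<forall>x\<in>P. \<forall>y\<in>P. mdist Z x y \<le> D k) \<or> P \<subseteq> (\<Union>i<Suc m. \<Union>(\<U> i k))"
        using multiscale_systemD(3)[OF sub k] unfolding mspace_submetric mdist_submetric PZ .
      ultimately show ?thesis
        unfolding lessThan_Suc by blast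
    qed
    have "multiscale_system m (max K L) D (submetric Z P) \<U>"
    proof (rule multiscale_systemI)
      show "sparse_boundaries (submetric Z P) (\<U> i)" if "i < m" for i
        using multiscale_systemD(1)[OF sub] that by simp
    next
      show "mdist (submetric Z P) x y \<le> D k"
        if "i < m" "S \<in> \<U> i k" "x \<in> S" "y \<in> S"
          "x \<in> mspace (submetric Z P)" "y \<in> mspace (submetric Z P)" for i k S x y
        using multiscale_systemD(2)[OF sub _ that(2-6)] that(1) by simp
    qed (unfold mspace_submetric mdist_submetric PZ, rule alt)
    then show ?thesis using p by blast
  qed
  ultimately show ?thesis
    unfolding two_coloured_cover_def by (intro exI[of _ \<P>] conjI allI ballI impI) (simp, metis+)
qed

text \<open>
  Metric families have to be countable, whereas spaces may have any cardinality. This property is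
  inherited by subspaces and makes every family of far apart pieces countable.
\<close>

definition separated_sets_countable :: "real \<Rightarrow> 'a metric \<Rightarrow> bool" where
  "separated_sets_countable \<rho> Z \<longleftrightarrow>
     (\<forall>A\<subseteq>mspace Z. (\<forall>x\<in>A. \<forall>y\<in>A. x \<noteq> y \<longrightarrow> \<rho> < mdist Z x y) \<longrightarrow> countable A)"

lemma countable_separated_family:
  assumes "separated_sets_countable \<rho> Z" "\<And>P. P \<in> \<P> \<Longrightarrow> P \<noteq> {} \<and> P \<subseteq> mspace Z"
    and far: "\<And>P Q x y. P \<in> \<P> \<Longrightarrow> Q \<in> \<P> \<Longrightarrow> P \<noteq> Q \<Longrightarrow> x \<in> P \<Longrightarrow> y \<in> Q \<Longrightarrow> \<rho> < mdist Z x y"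
    and disj: "disjoint \<P>"
  shows "countable \<P>"
proof -
  define f where "f P = (SOME x. x \<in> P)" for P :: "'a set"
  have f: "f P \<in> P" if "P \<in> \<P>" for P
    unfolding f_def using assms(2)[OF that] by (simp add: some_in_eq)
  have "countable (f ` \<P>)"
  proof -
    have "\<rho> < mdist Z x y" if "x \<in> f ` \<P>" "y \<in> f ` \<P>" "x \<noteq> y" for x y
      using that f far by blast
    moreover have "f ` \<P> \<subseteq> mspace Z" using f assms(2) by blast
    ultimately show ?thesis
      using assms(1) unfolding separated_sets_countable_def by meson
  qed
  moreover have "inj_on f \<P>"
  proof (rule inj_onI, rule ccontr)
    fix P Q assume PQ: "P \<in> \<P>" "Q \<in> \<P>" "f P = f Q" "P \<noteq> Q"
    then have "f P \<in> P \<inter> Q" using f by (metis IntI)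
    then show False using disjointD[OF disj PQ(1,2,4)] by blast
  qed
  ultimately show ?thesis
    by (rule countable_image_inj_on)
qed

text \<open>
  Induction on the number of colours left. The cut is made at a level \<open>L\<close> above both the required
  distance \<open>r\<close> and \<open>\<rho>\<close>, the latter to keep the family of pieces countable.
\<close>

lemma multiscale_systems_fdc:
  fixes \<F> :: "'a metric set"
  assumes "countable \<F>"
    and "\<And>Z. Z \<in> \<F> \<Longrightarrow> separated_sets_countable \<rho> Z"
    and "\<And>Z. Z \<in> \<F> \<Longrightarrow> \<exists>\<U>. multiscale_system m K D Z \<U>"
  shows "\<F> \<in> fdc_families"
  using assms
proof (induction m arbitrary: \<F> K)
  case 0
  have "mdist Z x y \<le> D K" if "Z \<in> \<F>" "x \<in> mspace Z" "y \<in> mspace Z" for Z x y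
    using "0.prems"(3)[OF that(1)] multiscale_systemD(3)[of 0 K D Z _ K] that by auto
  then have "\<F> \<in> bounded_families"
    using "0.prems"(1) by (rule bounded_familiesI[rotated])
  then show ?case
    using bounded_families_fdc by blast
next
  case (Suc m)
  have "\<exists>\<Y>\<in>fdc_families. rn_decomposable r 1 \<F> \<Y>" if r: "0 < r" for r
  proof -
    define L where "L = nat \<lceil>max r \<rho> + 1\<rceil>"
    have L: "r < real L" "\<rho> < real L"
      unfolding L_def by linarith+
    have "\<forall>Z\<in>\<F>. \<exists>\<P>. two_coloured_cover (real L) Z \<P> \<and>
        (\<forall>b. \<forall>P\<in>\<P> b. \<exists>\<U>. multiscale_system m (max K L) D (submetric Z P) \<U>)"
    proof
      fix Z assume "Z \<in> \<F>"
      then obtain \<U> where "multiscale_system (Suc m) K D Z \<U>"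
        using Suc.prems(3) by blast
      from cut_along_sparse_family[OF this, of L]
      show "\<exists>\<P>. two_coloured_cover (real L) Z \<P> \<and>
          (\<forall>b. \<forall>P\<in>\<P> b. \<exists>\<U>. multiscale_system m (max K L) D (submetric Z P) \<U>)"
        by fast
    qed
    from bchoice[OF this] obtain \<P> where \<P>: "\<forall>Z\<in>\<F>. two_coloured_cover (real L) Z (\<P> Z) \<and>
        (\<forall>b. \<forall>P\<in>\<P> Z b. \<exists>\<U>. multiscale_system m (max K L) D (submetric Z P) \<U>)"
      by (elim exE)
    have cover: "mspace Z = (\<Union>b. \<Union>(\<P> Z b))" if "Z \<in> \<F>" for Z
      using \<P> that unfolding two_coloured_cover_def by simp
    have far: "real L < mdist Z x y"
      if "Z \<in> \<F>" "P \<in> \<P> Z b" "Q \<in> \<P> Z b" "P \<noteq> Q" "x \<in> P" "y \<in> Q" for Z b P Q x y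
      using bspec[OF \<P> that(1)] that(2-) unfolding two_coloured_cover_def by meson
    have piece: "P \<noteq> {} \<and> (\<exists>\<U>. multiscale_system m (max K L) D (submetric Z P) \<U>)"
      if "Z \<in> \<F>" "P \<in> \<P> Z b" for Z b P
      using bspec[OF \<P> that(1)] that(2) unfolding two_coloured_cover_def by metis
    have sub: "P \<subseteq> mspace Z" if "Z \<in> \<F>" "P \<in> \<P> Z b" for Z P b
      using cover[OF that(1)] that(2) by blast
    define \<Y> where "\<Y> = (\<Union>Z\<in>\<F>. \<Union>b. submetric Z ` \<P> Z b)"
    have cnt: "countable (\<P> Z b)" if Z: "Z \<in> \<F>" for Z b
    proof (rule countable_separated_family[OF Suc.prems(2)[OF Z]])
      show "\<rho> < mdist Z x y" if "P \<in> \<P> Z b" "Q \<in> \<P> Z b" "P \<noteq> Q" "x \<in> P" "y \<in> Q" for P Q x y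
        using far[OF Z that] L(2) by linarith
      show "disjoint (\<P> Z b)"
      proof (rule disjointI)
        fix P Q assume PQ: "P \<in> \<P> Z b" "Q \<in> \<P> Z b" "P \<noteq> Q"
        have False if "x \<in> P" "x \<in> Q" for x
        proof -
          have "x \<in> mspace Z" using sub[OF Z PQ(1)] that by blast
          then have "mdist Z x x = 0" by simp
          then show False using far[OF Z PQ that] by simp
        qed
        then show "P \<inter> Q = {}" by blast
      qed
    qed (use piece[OF Z] sub[OF Z] in blast)
    have "countable \<Y>"
      unfolding \<Y>_def using Suc.prems(1) cnt by auto
    moreover have "separated_sets_countable \<rho> Y" if "Y \<in> \<Y>" for Y
      using that Suc.prems(2) unfolding \<Y>_def separated_sets_countable_def by fastforce
    moreover have "\<exists>\<U>. multiscale_system m (max K L) D Y \<U>" if "Y \<in> \<Y>" for Y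
      using that piece unfolding \<Y>_def by blast
    ultimately have "\<Y> \<in> fdc_families"
      by (rule Suc.IH)
    moreover have "rn_decomposable r 1 \<F> \<Y>"
      unfolding rn_decomposable_def
    proof
      fix Z assume Z: "Z \<in> \<F>"
      define A where "A i = \<Union>(\<P> Z (i = 0))" for i :: nat
      have "mspace Z = (\<Union>i\<le>1. A i)"
        unfolding cover[OF Z] A_def by (simp add: atMost_Suc UNIV_bool)
      moreover have "r_disjoint_union_over Z r \<Y> (A i)" for i
        unfolding r_disjoint_union_over_def A_def
      proof (intro exI[of _ "\<P> Z (i = 0)"] conjI ballI refl)
        show "r_disjoint Z r (\<P> Z (i = 0))"
          using r L(1) by (intro r_disjointI[of r "real L"] less_imp_le[OF far[OF Z]]) auto
      qed (use sub[OF Z] Z in \<open>auto simp: \<Y>_def\<close>)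
      ultimately show "\<exists>A :: nat \<Rightarrow> 'a set. mspace Z = (\<Union>i\<le>1. A i) \<and> (\<forall>i\<le>1. r_disjoint_union_over Z r \<Y> (A i))"
        by (intro exI[of _ A]) simp
    qed
    ultimately show ?thesis by (rule bexI[rotated])
  qed
  then have "strongly_decomposable \<F> fdc_families"
    unfolding strongly_decomposable_def n_decomposable_def by blast
  then show ?case
    using fdc_families_closed Suc.prems(1)
    unfolding closed_under_strong_decomposition_def metric_family_def by blast
qed

section \<open>Sparse families from separated layers\<close>

lemma equiv_Un_blocks:
  assumes "equiv A r"
    and "\<And>i. i \<in> I \<Longrightarrow> W i \<subseteq> A" "\<And>i. i \<in> I \<Longrightarrow> r `` W i \<subseteq> W i"
    and "\<And>i j. i \<in> I \<Longrightarrow> j \<in> I \<Longrightarrow> i \<noteq> j \<Longrightarrow> W i \<inter> W j = {}"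
  shows "equiv A (r \<union> (\<Union>i\<in>I. W i \<times> W i))" (is "equiv A ?s")
proof (rule equivI)
  have r: "refl_on A r" "sym r" "trans r" "r \<subseteq> A \<times> A"
    using assms(1) by (auto elim: equivE)
  show "?s \<subseteq> A \<times> A" using r(4) assms(2) by blast
  show "refl_on A ?s" using r(1) unfolding refl_on_def by blast
  show "sym ?s" using r(2) unfolding sym_def by blast
  show "trans ?s"
  proof (rule transI)
    fix x y z assume xy: "(x, y) \<in> ?s" and yz: "(y, z) \<in> ?s"
    have in_block: "v \<in> W i" if "(u, v) \<in> ?s" "u \<in> W i" "i \<in> I" for u v i
      using that assms(3)[of i] assms(4)[of i] by blast
    show "(x, z) \<in> ?s"
    proof (cases "(x, y) \<in> r \<and> (y, z) \<in> r")
      case True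
      then show ?thesis using transD[OF r(3)] by blast
    next
      case False
      then consider i where "i \<in> I" "x \<in> W i" "y \<in> W i" | i where "i \<in> I" "y \<in> W i" "z \<in> W i"
        using xy yz by blast
      then show ?thesis
      proof cases
        case 1
        then show ?thesis using in_block[OF yz] by blast
      next
        case 2
        have "(y, x) \<in> ?s" using xy \<open>sym ?s\<close> by (blast dest: symD)
        then show ?thesis using in_block[of y x] 2 by blast
      qed
    qed
  qed
qed

definition neighbourhood :: "'a metric \<Rightarrow> real \<Rightarrow> 'a set \<Rightarrow> 'a set" where
  "neighbourhood Z g S = {y \<in> mspace Z. \<exists>x\<in>S. mdist Z x y \<le> g}"

text \<open>
  The levels of a sparse family are built from the bottom up. Each layer \<open>\<V> k\<close> is a family of bounded sets
  whose gaps are large compared with \<open>C k\<close>, which bounds the clusters formed by all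
  the lower levels.
\<close>

locale separated_layers =
  fixes Z :: "'a metric" and \<V> :: "nat \<Rightarrow> 'a set set" and C E :: "nat \<Rightarrow> real"
  assumes layer_subset: "V \<in> \<V> k \<Longrightarrow> V \<subseteq> mspace Z"
    and layer_bound: "V \<in> \<V> k \<Longrightarrow> x \<in> V \<Longrightarrow> y \<in> V \<Longrightarrow> mdist Z x y \<le> E k"
    and layer_gap: "V \<in> \<V> k \<Longrightarrow> V' \<in> \<V> k \<Longrightarrow> V \<noteq> V' \<Longrightarrow> x \<in> V \<Longrightarrow> y \<in> V' \<Longrightarrow>
        4 * C k + 2 * real k < mdist Z x y"
    and C_0: "0 \<le> C 0"
    and C_Suc: "4 * C k + 2 * real k + E k \<le> C (Suc k)"
    and E_nonneg: "0 \<le> E k"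
begin

text \<open>
  Two points are related by \<open>glued k\<close> if boundary zones of levels below \<open>k\<close> tie them together. The core of a
  member of layer \<open>k\<close> is its saturation under this relation, so its boundary crosses none of those
  zones. The halo is the saturated zone of width \<open>k\<close> around the core, and each halo
  becomes part of one class at the next level.
\<close>

primrec glued :: "nat \<Rightarrow> ('a \<times> 'a) set" where
  "glued 0 = Id_on (mspace Z)"
| "glued (Suc k) = glued k \<union>
     (\<Union>V\<in>\<V> k. (glued k `` neighbourhood Z (real k) (glued k `` V)) \<times>
               (glued k `` neighbourhood Z (real k) (glued k `` V)))"

definition core :: "nat \<Rightarrow> 'a set \<Rightarrow> 'a set" where
  "core k V = glued k `` V"

definition halo :: "nat \<Rightarrow> 'a set \<Rightarrow> 'a set" where
  "halo k V = glued k `` neighbourhood Z (real k) (core k V)"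

lemma glued_Suc: "glued (Suc k) = glued k \<union> (\<Union>V\<in>\<V> k. halo k V \<times> halo k V)"
  by (simp add: halo_def core_def)

lemma C_nonneg: "0 \<le> C k"
proof (induction k)
  case (Suc k)
  then show ?case using C_Suc[of k] E_nonneg[of k] by linarith
qed (rule C_0)

text \<open>
  The bound comes from two steps within a class, of length \<open>C k\<close> each, and one step of length \<open>k\<close>. Two halos of
  level \<open>k\<close> that meet would thus bring their layer members within \<open>4 * C k + 2 * k\<close>, which is the gap
  required of a layer.
\<close>

lemma halo_near_layer:
  assumes "equiv (mspace Z) (glued k)" and bound: "\<And>x y. (x, y) \<in> glued k \<Longrightarrow> mdist Z x y \<le> C k"
    and "w \<in> halo k V"
  shows "w \<in> mspace Z \<and> (\<exists>v\<in>V. v \<in> mspace Z \<and> mdist Z v w \<le> 2 * C k + real k)"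
proof -
  have sub: "glued k \<subseteq> mspace Z \<times> mspace Z"
    using assms(1) by (auto elim: equivE)
  obtain a u v where *: "(a, w) \<in> glued k" "mdist Z u a \<le> real k" "(v, u) \<in> glued k" "v \<in> V"
    using assms(3) unfolding halo_def core_def neighbourhood_def by blast
  have "v \<in> mspace Z" "u \<in> mspace Z" "a \<in> mspace Z" "w \<in> mspace Z"
    using * sub by auto
  then have "mdist Z v w \<le> mdist Z v u + mdist Z u a + mdist Z a w"
    by (intro mdist_triangle3)
  also have "\<dots> \<le> 2 * C k + real k"
    using bound[OF *(1)] bound[OF *(3)] *(2) by linarith
  finally show ?thesis using * \<open>w \<in> mspace Z\<close> \<open>v \<in> mspace Z\<close> by blast
qed

lemma halo_disjoint:
  assumes eq: "equiv (mspace Z) (glued k)" "\<And>x y. (x, y) \<in> glued k \<Longrightarrow> mdist Z x y \<le> C k"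
    and V: "V \<in> \<V> k" "V' \<in> \<V> k" "V \<noteq> V'"
  shows "halo k V \<inter> halo k V' = {}"
proof (rule ccontr)
  assume "halo k V \<inter> halo k V' \<noteq> {}"
  then obtain w where w: "w \<in> halo k V" "w \<in> halo k V'" by blast
  obtain v where v: "v \<in> V" "v \<in> mspace Z" "mdist Z v w \<le> 2 * C k + real k" and wZ: "w \<in> mspace Z"
    using halo_near_layer[OF eq w(1)] by blast
  obtain v' where v': "v' \<in> V'" "v' \<in> mspace Z" "mdist Z v' w \<le> 2 * C k + real k"
    using halo_near_layer[OF eq w(2)] by blast
  have "mdist Z v v' \<le> mdist Z v w + mdist Z w v'"
    using v(2) wZ v'(2) by (rule mdist_triangle)
  then have "mdist Z v v' \<le> 4 * C k + 2 * real k"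
    using v(3) v'(3) mdist_commute[of Z w v'] by linarith
  then show False
    using layer_gap[OF V v(1) v'(1)] by simp
qed

text \<open>
  As halos of one level are disjoint and saturated, gluing each of them to a single class is
  transitive without taking a closure. This is what keeps the classes bounded.
\<close>

lemma glued_equiv_bounded:
  "equiv (mspace Z) (glued k) \<and> (\<forall>x y. (x, y) \<in> glued k \<longrightarrow> mdist Z x y \<le> C k)"
proof (induction k)
  case 0
  have "equiv (mspace Z) (Id_on (mspace Z))"
    by (auto simp: equiv_def refl_on_def sym_def trans_def)
  then show ?case
    using C_0 by (auto simp: mdist_self)
next
  case (Suc k)
  then have eq: "equiv (mspace Z) (glued k)"
    and bd: "\<And>x y. (x, y) \<in> glued k \<Longrightarrow> mdist Z x y \<le> C k" by auto
  have "trans (glued k)"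
    using eq by (auto elim: equivE)
  then have "glued k `` halo k V \<subseteq> halo k V" for V
    unfolding halo_def by (blast dest: transD)
  moreover have "halo k V \<subseteq> mspace Z" for V
    using halo_near_layer[OF eq bd] by blast
  ultimately have "equiv (mspace Z) (glued (Suc k))"
    unfolding glued_Suc using halo_disjoint[OF eq bd] eq by (intro equiv_Un_blocks) auto
  moreover have "mdist Z x y \<le> C (Suc k)" if xy: "(x, y) \<in> glued (Suc k)" for x y
  proof -
    consider "(x, y) \<in> glued k" | V where "V \<in> \<V> k" "x \<in> halo k V" "y \<in> halo k V"
      using xy unfolding glued_Suc by blast
    then show ?thesis
    proof cases
      case 1
      then show ?thesis using bd[OF 1] C_Suc[of k] E_nonneg[of k] C_nonneg[of k] by linarith
    next
      case 2
      obtain v where v: "v \<in> V" "v \<in> mspace Z" "mdist Z v x \<le> 2 * C k + real k" and x: "x \<in> mspace Z"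
        using halo_near_layer[OF eq bd 2(2)] by blast
      obtain v' where v': "v' \<in> V" "v' \<in> mspace Z" "mdist Z v' y \<le> 2 * C k + real k" and y: "y \<in> mspace Z"
        using halo_near_layer[OF eq bd 2(3)] by blast
      have "mdist Z x y \<le> mdist Z x v + mdist Z v v' + mdist Z v' y"
        using x v(2) v'(2) y by (rule mdist_triangle3)
      then show ?thesis
        using v(3) v'(3) layer_bound[OF 2(1) v(1) v'(1)] C_Suc[of k] mdist_commute[of Z x v] by linarith
    qed
  qed
  ultimately show ?case by blast
qed

lemmas glued_equiv = conjunct1[OF glued_equiv_bounded]
lemmas glued_bounded = glued_equiv_bounded[THEN conjunct2, rule_format]

lemma glued_refl: "x \<in> mspace Z \<Longrightarrow> (x, x) \<in> glued k"
  using glued_equiv[of k] by (auto elim: equivE dest: refl_onD)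

lemma glued_mono: "k \<le> l \<Longrightarrow> glued k \<subseteq> glued l"
  by (rule lift_Suc_mono_le) (auto simp: glued_Suc)

lemma core_saturated: "(x, y) \<in> glued k \<Longrightarrow> x \<in> core k V \<longleftrightarrow> y \<in> core k V"
  using glued_equiv[of k] unfolding core_def
  by (auto elim!: equivE dest: transD symD)

lemma separated_in_halo:
  assumes "x \<in> mspace Z" "y \<in> mspace Z" "mdist Z x y \<le> real k" "(x \<in> core k V) \<noteq> (y \<in> core k V)"
  shows "x \<in> halo k V \<and> y \<in> halo k V"
proof -
  have *: "u \<in> halo k V \<and> v \<in> halo k V"
    if uv: "u \<in> mspace Z" "v \<in> mspace Z" "mdist Z u v \<le> real k" "u \<in> core k V" for u v
  proof -
    have "mdist Z u u \<le> real k" using uv(1) by (simp add: mdist_self)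
    then have "u \<in> neighbourhood Z (real k) (core k V)" "v \<in> neighbourhood Z (real k) (core k V)"
      using uv unfolding neighbourhood_def by blast+
    then show ?thesis
      using glued_refl uv unfolding halo_def by blast
  qed
  show ?thesis
    using *[of x y] *[of y x] assms mdist_commute[of Z x y] by auto
qed

lemma core_subset_halo: "V \<in> \<V> k \<Longrightarrow> core k V \<subseteq> halo k V"
proof
  fix x assume x: "x \<in> core k V"
  have "x \<in> mspace Z"
    using x glued_equiv[of k] unfolding core_def by (auto elim!: equivE)
  then have "x \<in> neighbourhood Z (real k) (core k V)"
    using x unfolding neighbourhood_def by (auto intro!: bexI[of _ x] simp: mdist_self)
  then show "x \<in> halo k V"
    using glued_refl \<open>x \<in> mspace Z\<close> unfolding halo_def by blast
qed

text \<open>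
  If a core of level \<open>k\<close> separates two points at distance at most \<open>k\<close>, both lie in its halo. A second
  core of level \<open>k\<close> cannot do the same, because halos are disjoint, and a core of a higher level
  cannot separate the two points, because it is saturated and they are already glued.
\<close>

lemma cores_sparse: "sparse_boundaries Z (\<lambda>k. core k ` \<V> k)"
proof -
  have *: "S = T"
    if kl: "k \<le> l" and ST: "S \<in> core k ` \<V> k" "T \<in> core l ` \<V> l"
      and xy: "x \<in> mspace Z" "y \<in> mspace Z" "mdist Z x y \<le> real k"
      and sep: "(x \<in> S) \<noteq> (y \<in> S)" "(x \<in> T) \<noteq> (y \<in> T)" for k l S T x y
  proof -
    obtain V V' where V: "V \<in> \<V> k" "S = core k V" and V': "V' \<in> \<V> l" "T = core l V'"
      using ST by blast
    have h: "x \<in> halo k V \<and> y \<in> halo k V"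
      using xy sep(1) unfolding V(2) by (rule separated_in_halo)
    have h': "x \<in> halo l V' \<and> y \<in> halo l V'"
      using xy(1,2) _ sep(2) unfolding V'(2)
      by (rule separated_in_halo) (use xy(3) kl in linarith)
    show ?thesis
    proof (cases "k = l")
      case True
      then have "V = V'"
        using halo_disjoint[OF glued_equiv glued_bounded, where k = k and V = V and V' = V'] V(1) V'(1) h h' by blast
      then show ?thesis using True V V' by simp
    next
      case False
      then have "Suc k \<le> l" using kl by simp
      moreover have "(x, y) \<in> glued (Suc k)"
        using h V(1) unfolding glued_Suc by blast
      ultimately have "(x, y) \<in> glued l"
        using glued_mono by blast
      then show ?thesis
        using core_saturated[of x y l V'] sep(2) V'(2) by blast
    qed
  qed
  show ?thesis
    unfolding sparse_boundaries_def
  proof (intro allI ballI impI)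
    fix k l S T x y
    assume a: "S \<in> core k ` \<V> k" "T \<in> core l ` \<V> l" "x \<in> mspace Z" "y \<in> mspace Z"
      "mdist Z x y \<le> real (min k l)" "(x \<in> S) \<noteq> (y \<in> S)" "(x \<in> T) \<noteq> (y \<in> T)"
    show "S = T"
    proof (cases "k \<le> l")
      case True
      then show ?thesis using *[of k l S T x y] a by simp
    next
      case False
      then show ?thesis using *[of l k T S x y] a by simp
    qed
  qed
qed

lemma core_bounded:
  assumes "V \<in> \<V> k" "x \<in> core k V" "y \<in> core k V"
  shows "mdist Z x y \<le> C (Suc k)"
proof (rule glued_bounded)
  show "(x, y) \<in> glued (Suc k)"
    using core_subset_halo[OF assms(1)] assms unfolding glued_Suc by blast
qed

lemma layer_subset_core: "V \<in> \<V> k \<Longrightarrow> V \<subseteq> core k V"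
  using layer_subset glued_refl unfolding core_def by blast

end

section \<open>Finite asymptotic dimension implies finite decomposition complexity\<close>

text \<open>
  A witness for asymptotic dimension at most \<open>n\<close> at scale \<open>s\<close>. The members are countably many because metric families
  are countable, and this keeps the pieces countable in later decompositions.
\<close>

definition coloured_cover :: "nat \<Rightarrow> real \<Rightarrow> real \<Rightarrow> 'a metric \<Rightarrow> (nat \<Rightarrow> 'a set set) \<Rightarrow> bool" where
  "coloured_cover n s B Z \<U> \<longleftrightarrow>
     mspace Z = (\<Union>i\<le>n. \<Union>(\<U> i)) \<and>
     (\<forall>i\<le>n. \<forall>U\<in>\<U> i. \<forall>x\<in>U. \<forall>y\<in>U. mdist Z x y \<le> B) \<and>
     (\<forall>i\<le>n. \<forall>U\<in>\<U> i. \<forall>V\<in>\<U> i. U \<noteq> V \<longrightarrow> (\<forall>x\<in>U. \<forall>y\<in>V. s < mdist Z x y)) \<and>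
     (\<forall>i\<le>n. countable (\<U> i))"

lemma coloured_coverD:
  assumes "coloured_cover n s B Z \<U>"
  shows "mspace Z = (\<Union>i\<le>n. \<Union>(\<U> i))"
    and "i \<le> n \<Longrightarrow> U \<in> \<U> i \<Longrightarrow> x \<in> U \<Longrightarrow> y \<in> U \<Longrightarrow> mdist Z x y \<le> B"
    and "i \<le> n \<Longrightarrow> U \<in> \<U> i \<Longrightarrow> V \<in> \<U> i \<Longrightarrow> U \<noteq> V \<Longrightarrow> x \<in> U \<Longrightarrow> y \<in> V \<Longrightarrow> s < mdist Z x y"
    and "i \<le> n \<Longrightarrow> countable (\<U> i)"
    and "i \<le> n \<Longrightarrow> U \<in> \<U> i \<Longrightarrow> U \<subseteq> mspace Z"
proof -
  show eq: "mspace Z = (\<Union>i\<le>n. \<Union>(\<U> i))"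
    using assms unfolding coloured_cover_def by (rule conjunct1)
  show "i \<le> n \<Longrightarrow> U \<in> \<U> i \<Longrightarrow> U \<subseteq> mspace Z"
    unfolding eq by blast
qed (use assms in \<open>simp_all add: coloured_cover_def\<close>)

text \<open>
  Each of the countably many members contains at most one point of a set whose points are more than
  \<open>B\<close> apart.
\<close>

lemma separated_sets_countable_coloured_cover:
  assumes "coloured_cover n s B Z \<U>"
  shows "separated_sets_countable B Z"
  unfolding separated_sets_countable_def
proof (intro allI impI)
  fix A assume A: "A \<subseteq> mspace Z" "\<forall>x\<in>A. \<forall>y\<in>A. x \<noteq> y \<longrightarrow> B < mdist Z x y"
  note cover = coloured_coverD[OF assms]
  have "A \<subseteq> (\<Union>i\<le>n. \<Union>U\<in>\<U> i. A \<inter> U)"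
    using A(1) cover(1) by auto
  moreover have "countable (A \<inter> U)" if "i \<le> n" "U \<in> \<U> i" for i U
  proof -
    have "x = y" if "x \<in> A \<inter> U" "y \<in> A \<inter> U" for x y
      using that A(2) cover(2)[OF \<open>i \<le> n\<close> \<open>U \<in> \<U> i\<close>, of x y] by (metis Int_iff not_less)
    then have "A \<inter> U \<subseteq> {SOME x. x \<in> A \<inter> U}"
      by (metis insertI1 someI subsetI)
    then show ?thesis by (rule countable_subset) simp
  qed
  then have "countable (\<Union>i\<le>n. \<Union>U\<in>\<U> i. A \<inter> U)"
    using cover(4) by (intro countable_UN) auto
  ultimately show "countable A"
    by (rule countable_subset)
qed

lemma multiscale_system_exists:
  assumes "\<And>k. \<exists>\<U>. coloured_cover n (4 * C k + 2 * real k + 1) (E k) Z \<U>"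
    and "0 \<le> C 0" "\<And>k. 4 * C k + 2 * real k + E k \<le> C (Suc k)" "\<And>k. 0 \<le> E k"
  shows "\<exists>\<U>. multiscale_system (Suc n) 0 (\<lambda>k. C (Suc k)) Z \<U>"
proof -
  obtain \<V> where cover: "\<And>k. coloured_cover n (4 * C k + 2 * real k + 1) (E k) Z (\<V> k)"
    using assms(1) by metis
  have "\<exists>W. sparse_boundaries Z W \<and>
      (\<forall>k. \<forall>S\<in>W k. \<forall>x\<in>S. \<forall>y\<in>S. mdist Z x y \<le> C (Suc k)) \<and>
      (\<forall>k. \<Union>(\<V> k i) \<subseteq> \<Union>(W k))" if i: "i \<le> n" for i
  proof -
    interpret separated_layers Z "\<lambda>k. \<V> k i" C E
    proof
      show "4 * C k + 2 * real k < mdist Z x y"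
        if "V \<in> \<V> k i" "V' \<in> \<V> k i" "V \<noteq> V'" "x \<in> V" "y \<in> V'" for V V' k x y
        using coloured_coverD(3)[OF cover i that] by linarith
    qed (use coloured_coverD(2,5)[OF cover i] assms(2-4) in auto)
    have "\<Union>(\<V> k i) \<subseteq> \<Union>(core k ` \<V> k i)" for k
      using layer_subset_core by (intro UN_mono[where f = "\<lambda>V. V", simplified]) auto
    then show ?thesis
      using cores_sparse core_bounded
      by (intro exI[of _ "\<lambda>k. core k ` \<V> k i"] conjI allI ballI) auto
  qed
  then have "\<forall>i\<in>{..n}. \<exists>W. sparse_boundaries Z W \<and>
      (\<forall>k. \<forall>S\<in>W k. \<forall>x\<in>S. \<forall>y\<in>S. mdist Z x y \<le> C (Suc k)) \<and>
      (\<forall>k. \<Union>(\<V> k i) \<subseteq> \<Union>(W k))" by simp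
  from bchoice[OF this] obtain W where W: "\<forall>i\<in>{..n}. sparse_boundaries Z (W i) \<and>
      (\<forall>k. \<forall>S\<in>W i k. \<forall>x\<in>S. \<forall>y\<in>S. mdist Z x y \<le> C (Suc k)) \<and>
      (\<forall>k. \<Union>(\<V> k i) \<subseteq> \<Union>(W i k))"
    by (elim exE)
  have "multiscale_system (Suc n) 0 (\<lambda>k. C (Suc k)) Z W"
  proof (rule multiscale_systemI)
    fix k
    have "mspace Z = (\<Union>i\<le>n. \<Union>(\<V> k i))"
      by (rule coloured_coverD(1)[OF cover])
    also have "\<dots> \<subseteq> (\<Union>i\<le>n. \<Union>(W i k))"
      using W by (intro UN_mono) auto
    finally show "(\<forall>x\<in>mspace Z. \<forall>y\<in>mspace Z. mdist Z x y \<le> C (Suc k)) \<or>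
        mspace Z \<subseteq> (\<Union>i<Suc n. \<Union>(W i k))"
      by (simp add: lessThan_Suc_atMost)
  next
    show "sparse_boundaries Z (W i)" if "i < Suc n" for i
      using W that by simp
  next
    show "mdist Z x y \<le> C (Suc k)" if "i < Suc n" "S \<in> W i k" "x \<in> S" "y \<in> S" for i k S x y
      using bspec[OF W, of i] that by simp
  qed
  then show ?thesis by (rule exI[of _ W])
qed

text \<open>
  The control function \<open>B\<close> determines a sequence \<open>C\<close> common to all members of the family, so that the
  systems on the different members have the same diameter bounds.
\<close>

lemma finite_asymptotic_dimension_fdc:
  fixes \<F> :: "'a metric set"
  assumes "metric_family \<F>"
    and "\<And>s. 0 < s \<Longrightarrow> \<exists>B\<ge>0. \<forall>Z\<in>\<F>. \<exists>\<U>. coloured_cover n s B Z \<U>"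
  shows "\<F> \<in> fdc_families"
proof -
  obtain B where B: "\<And>s. 0 < s \<Longrightarrow> 0 \<le> B s"
    "\<And>s Z. 0 < s \<Longrightarrow> Z \<in> \<F> \<Longrightarrow> \<exists>\<U>. coloured_cover n s (B s) Z \<U>"
    using assms(2) by metis
  define C where "C = rec_nat 0 (\<lambda>k c. 4 * c + 2 * real k + B (4 * c + 2 * real k + 1))"
  have C_0: "C 0 = 0" and C_Suc: "C (Suc k) = 4 * C k + 2 * real k + B (4 * C k + 2 * real k + 1)" for k
    unfolding C_def by simp_all
  have C_nonneg: "0 \<le> C k" for k
  proof (induction k)
    case (Suc k)
    then show ?case using B(1)[of "4 * C k + 2 * real k + 1"] unfolding C_Suc by linarith
  qed (simp add: C_0)
  define s where "s k = 4 * C k + 2 * real k + 1" for k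
  have s: "0 < s k" for k
    using C_nonneg[of k] unfolding s_def by linarith
  have "\<exists>\<U>. multiscale_system (Suc n) 0 (\<lambda>k. C (Suc k)) Z \<U>" if Z: "Z \<in> \<F>" for Z
  proof (rule multiscale_system_exists[where E = "\<lambda>k. B (s k)"])
    show "\<exists>\<U>. coloured_cover n (4 * C k + 2 * real k + 1) (B (s k)) Z \<U>" for k
      using B(2)[OF s[of k] Z] unfolding s_def .
  qed (use C_0 C_Suc B(1)[OF s] in \<open>simp_all add: s_def\<close>)
  moreover have "separated_sets_countable (B 1) Z" if "Z \<in> \<F>" for Z
    using B(2)[of 1 Z] that separated_sets_countable_coloured_cover by (metis zero_less_one)
  moreover have "countable \<F>"
    using assms(1) unfolding metric_family_def .
  ultimately show ?thesis
    by (intro multiscale_systems_fdc)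
qed

section \<open>Large scale doubling\<close>

text \<open>
  The doubling condition is applied at the radii \<open>2 ^ i * s\<close> with \<open>i < j\<close>; all of them are at least
  \<open>R\<close>, which is where \<open>R \<le> s\<close> enters.
\<close>

lemma doubling_iterate:
  assumes "large_scale_doubling_subset X N R Y" "R \<le> s" "0 < s" "x \<in> mspace X"
  shows "\<exists>C\<subseteq>mspace X. finite C \<and> card C \<le> N ^ j \<and>
           Y \<inter> mball_of X x (2 ^ j * s) \<subseteq> (\<Union>c\<in>C. mball_of X c s)"
  using assms(4)
proof (induction j arbitrary: x)
  case 0
  then show ?case by (intro exI[of _ "{x}"]) auto
next
  case (Suc j)
  have R: "R \<le> 2 ^ j * s"
  proof -
    have "1 * s \<le> 2 ^ j * s" using assms(3) by (intro mult_right_mono) simp_all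
    then show ?thesis using assms(2) by simp
  qed
  obtain D where D: "D \<subseteq> mspace X" "finite D" "card D \<le> N"
      "Y \<inter> mball_of X x (2 * (2 ^ j * s)) \<subseteq> (\<Union>d\<in>D. mball_of X d (2 ^ j * s))"
    using assms(1)[unfolded large_scale_doubling_subset_def, rule_format, OF Suc.prems R]
    by (elim exE conjE)
  have "\<forall>d\<in>D. \<exists>C. C \<subseteq> mspace X \<and> finite C \<and> card C \<le> N ^ j \<and>
           Y \<inter> mball_of X d (2 ^ j * s) \<subseteq> (\<Union>c\<in>C. mball_of X c s)"
    using Suc.IH D(1) by blast
  from bchoice[OF this] obtain C where C: "\<forall>d\<in>D. C d \<subseteq> mspace X \<and> finite (C d) \<and> card (C d) \<le> N ^ j \<and>
           Y \<inter> mball_of X d (2 ^ j * s) \<subseteq> (\<Union>c\<in>C d. mball_of X c s)"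
    by (elim exE)
  have "card (\<Union>d\<in>D. C d) \<le> (\<Sum>d\<in>D. card (C d))"
    using D(2) by (rule card_UN_le)
  also have "\<dots> \<le> card D * N ^ j"
    using C sum_bounded_above[of D "\<lambda>d. card (C d)" "N ^ j"] by simp
  also have "\<dots> \<le> N ^ Suc j"
    using D(3) by simp
  finally have "card (\<Union>d\<in>D. C d) \<le> N ^ Suc j" .
  moreover have "Y \<inter> mball_of X x (2 ^ Suc j * s) \<subseteq> (\<Union>c\<in>(\<Union>d\<in>D. C d). mball_of X c s)"
  proof
    fix y assume y: "y \<in> Y \<inter> mball_of X x (2 ^ Suc j * s)"
    then obtain d where d: "d \<in> D" "y \<in> mball_of X d (2 ^ j * s)"
      using D(4) by (auto simp: mult.assoc)
    then have "y \<in> (\<Union>c\<in>C d. mball_of X c s)"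
      using C y by blast
    then show "y \<in> (\<Union>c\<in>(\<Union>d\<in>D. C d). mball_of X c s)"
      using d(1) by blast
  qed
  moreover have "(\<Union>d\<in>D. C d) \<subseteq> mspace X" "finite (\<Union>d\<in>D. C d)"
    using C D(2) by auto
  ultimately show ?case
    by (intro exI[of _ "\<Union>d\<in>D. C d"] conjI)
qed

definition separated :: "'a metric \<Rightarrow> real \<Rightarrow> 'a set \<Rightarrow> bool" where
  "separated X s A \<longleftrightarrow> (\<forall>x\<in>A. \<forall>y\<in>A. x \<noteq> y \<longrightarrow> s \<le> mdist X x y)"

text \<open>
  A ball of radius \<open>s\<close> contains at most one point of \<open>A\<close>.
\<close>

lemma separated_in_ball_card:
  assumes doubling: "large_scale_doubling_subset X N R Y" "R \<le> s" "0 < s"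
    and A: "A \<subseteq> Y" "separated X (2 * s) A" and "x \<in> mspace X"
  shows "finite (A \<inter> mball_of X x (2 ^ j * s)) \<and> card (A \<inter> mball_of X x (2 ^ j * s)) \<le> N ^ j"
proof -
  let ?B = "A \<inter> mball_of X x (2 ^ j * s)"
  obtain C where C: "C \<subseteq> mspace X" "finite C" "card C \<le> N ^ j"
      "Y \<inter> mball_of X x (2 ^ j * s) \<subseteq> (\<Union>c\<in>C. mball_of X c s)"
    using doubling_iterate[OF doubling assms(6)] by blast
  have "\<forall>a\<in>?B. \<exists>c. c \<in> C \<and> a \<in> mball_of X c s"
    using C(4) A(1) by blast
  from bchoice[OF this] obtain f where f: "\<forall>a\<in>?B. f a \<in> C \<and> a \<in> mball_of X (f a) s"
    by (elim exE)
  have "inj_on f ?B"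
  proof (rule inj_onI, rule ccontr)
    fix a b assume ab: "a \<in> ?B" "b \<in> ?B" "f a = f b" "a \<noteq> b"
    then have ball: "a \<in> mball_of X (f a) s" "b \<in> mball_of X (f a) s"
      using bspec[OF f ab(1)] bspec[OF f ab(2)] by simp_all
    then have "mdist X a b \<le> mdist X a (f a) + mdist X (f a) b"
      by (intro mdist_triangle) auto
    with ball have "mdist X a b < 2 * s"
      using mdist_commute[of X a "f a"] unfolding in_mball_of by linarith
    then show False
      using ab A(2) unfolding separated_def by fastforce
  qed
  moreover have "f ` ?B \<subseteq> C" using f by blast
  ultimately show ?thesis
    using C(2,3) inj_on_finite[of f ?B C] card_inj_on_le[of f ?B C] by linarith
qed

lemma maximal_separated_subset:
  assumes "S \<subseteq> mspace X" "0 < s"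
  shows "\<exists>M\<subseteq>S. separated X s M \<and> (\<forall>x\<in>S. \<exists>y\<in>M. mdist X x y < s)"
proof -
  define \<A> where "\<A> = {M. M \<subseteq> S \<and> separated X s M}"
  have "\<Union>C \<in> \<A>" if C: "subset.chain \<A> C" for C
  proof -
    have "s \<le> mdist X x y" if xy: "x \<in> \<Union>C" "y \<in> \<Union>C" "x \<noteq> y" for x y
    proof -
      obtain P Q where "P \<in> C" "Q \<in> C" "x \<in> P" "y \<in> Q" using xy by blast
      then obtain M where "M \<in> C" "x \<in> M" "y \<in> M"
        using C unfolding subset.chain_def subset_chain_def by (meson C subsetD subset_chain_def)
      moreover have "M \<in> \<A>" using \<open>M \<in> C\<close> C unfolding subset_chain_def by blast
      ultimately show ?thesis
        using xy(3) unfolding \<A>_def separated_def by blast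
    qed
    moreover have "\<Union>C \<subseteq> S" using C unfolding \<A>_def subset_chain_def by blast
    ultimately show ?thesis unfolding \<A>_def separated_def by simp
  qed
  from subset_Zorn'[OF this] obtain M where M: "M \<in> \<A>" "\<And>M'. M' \<in> \<A> \<Longrightarrow> M \<subseteq> M' \<Longrightarrow> M' = M"
    by blast
  have "\<exists>y\<in>M. mdist X x y < s" if x: "x \<in> S" for x
  proof (rule ccontr)
    assume far: "\<not> (\<exists>y\<in>M. mdist X x y < s)"
    have "mdist X x x < s"
      using assms(2) mdist_self[OF subsetD[OF assms(1) x]] by simp
    then have "x \<notin> M" using far by blast
    moreover have "separated X s (insert x M)"
    proof -
      have "s \<le> mdist X x y" "s \<le> mdist X y x" if "y \<in> M" for y
        using far that mdist_commute[of X x y] by (metis not_less)+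
      then show ?thesis
        using M(1) unfolding \<A>_def separated_def by blast
    qed
    then have "insert x M \<in> \<A>"
      using M(1) x unfolding \<A>_def by simp
    ultimately show False
      using M(2)[of "insert x M"] by blast
  qed
  then show ?thesis
    using M(1) unfolding \<A>_def by (intro exI[of _ M]) simp
qed

text \<open>
  Remove maximal \<open>t\<close>-separated subsets from \<open>A\<close> one after the other. A point \<open>a\<close> that survives \<open>n + 1\<close> rounds has,
  by maximality, a point within \<open>t\<close> in each of the \<open>n + 1\<close> subsets removed, which is too
  many points of \<open>A\<close> in one ball.
\<close>

lemma separated_colouring:
  assumes A: "A \<subseteq> mspace X" and "0 < t"
    and few: "\<And>a. a \<in> A \<Longrightarrow> finite (A \<inter> mball_of X a t) \<and> card (A \<inter> mball_of X a t) \<le> n"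
  shows "\<exists>M. A = (\<Union>i\<le>n. M i) \<and> (\<forall>i. separated X t (M i))"
proof -
  have "\<forall>S\<in>Pow (mspace X). \<exists>M. M \<subseteq> S \<and> separated X t M \<and> (\<forall>x\<in>S. \<exists>y\<in>M. mdist X x y < t)"
    using maximal_separated_subset[OF _ assms(2)] by (intro ballI) simp
  from bchoice[OF this] obtain pick where "\<forall>S\<in>Pow (mspace X). pick S \<subseteq> S \<and>
      separated X t (pick S) \<and> (\<forall>x\<in>S. \<exists>y\<in>pick S. mdist X x y < t)"
    by (elim exE)
  then have pick: "pick S \<subseteq> S \<and> separated X t (pick S) \<and> (\<forall>x\<in>S. \<exists>y\<in>pick S. mdist X x y < t)"
    if "S \<subseteq> mspace X" for S
    using that by (elim bspec) simp
  define rest where "rest = rec_nat A (\<lambda>_ S. S - pick S)"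
  have rest_0: "rest 0 = A" and rest_Suc: "rest (Suc i) = rest i - pick (rest i)" for i
    unfolding rest_def by simp_all
  have anti: "rest j \<subseteq> rest i" if "i \<le> j" for i j
    by (rule lift_Suc_antimono_le[of rest, OF _ that]) (auto simp: rest_Suc)
  have rest_A: "rest i \<subseteq> A" for i
    using anti[of 0 i] rest_0 by simp
  then have rest_X: "rest i \<subseteq> mspace X" for i
    using A by blast
  have "rest (Suc n) = {}"
  proof (rule ccontr)
    assume "rest (Suc n) \<noteq> {}"
    then obtain a where a: "a \<in> rest (Suc n)" by blast
    then have aA: "a \<in> A" using rest_A by blast
    have "\<forall>i\<in>{..n}. \<exists>y. y \<in> pick (rest i) \<and> mdist X a y < t"
    proof
      fix i assume "i \<in> {..n}"
      then have "a \<in> rest i" using a anti[of i "Suc n"] by auto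
      then show "\<exists>y. y \<in> pick (rest i) \<and> mdist X a y < t"
        using pick[OF rest_X[of i]] by blast
    qed
    from bchoice[OF this] obtain y where y: "\<forall>i\<in>{..n}. y i \<in> pick (rest i) \<and> mdist X a (y i) < t"
      by (elim exE)
    have y_rest: "y i \<in> rest i" "y i \<notin> rest (Suc i)" if "i \<le> n" for i
      using y that pick[OF rest_X[of i]] unfolding rest_Suc by auto
    have "y i \<noteq> y j" if "i < j" "j \<le> n" for i j
      using y_rest[of i] y_rest[of j] anti[of "Suc i" j] that by auto
    then have "inj_on y {..n}"
      by (intro linorder_inj_onI) auto
    then have "card (y ` {..n}) = Suc n"
      by (simp add: card_image)
    moreover have "y ` {..n} \<subseteq> A \<inter> mball_of X a t"
      using y y_rest(1) rest_A A aA by fastforce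
    ultimately have "Suc n \<le> card (A \<inter> mball_of X a t)"
      using few[OF aA] card_mono by metis
    then show False using few[OF aA] by simp
  qed
  moreover have "A \<subseteq> rest j \<union> (\<Union>i<j. pick (rest i))" for j
  proof (induction j)
    case (Suc j)
    then show ?case unfolding rest_Suc lessThan_Suc by auto
  qed (simp add: rest_0)
  ultimately have "A \<subseteq> (\<Union>i<Suc n. pick (rest i))"
    by (metis sup_bot_left)
  moreover have "pick (rest i) \<subseteq> A" for i
    using pick[OF rest_X[of i]] rest_A[of i] by blast
  ultimately have "A = (\<Union>i\<le>n. pick (rest i))"
    unfolding lessThan_Suc_atMost by blast
  moreover have "separated X t (pick (rest i))" for i
    using pick[OF rest_X[of i]] by blast
  ultimately show ?thesis
    by (intro exI[of _ "\<lambda>i. pick (rest i)"]) simp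
qed

text \<open>
  The members are the traces on \<open>Y\<close> of the balls of radius \<open>2 * s\<close> around a maximal \<open>2 * s\<close>-separated set \<open>A\<close>. If their
  centres are at least \<open>8 * s\<close> apart, the balls are more than \<open>4 * s\<close> apart. So \<open>A\<close> is split into
  \<open>8 * s\<close>-separated parts, and as \<open>8 = 2 ^ 3\<close> a ball of that radius contains at most \<open>N ^ 3\<close> points of \<open>A\<close>.
\<close>

lemma doubling_coloured_cover:
  assumes doubling: "large_scale_doubling_subset X N R Y" and Y: "Y \<subseteq> mspace X"
    and s: "R \<le> s" "0 < s" "r \<le> s"
  shows "\<exists>\<U>. coloured_cover (N ^ 3) r (4 * s) (submetric X Y) \<U>"
proof -
  obtain A where A: "A \<subseteq> Y" "separated X (2 * s) A" "\<And>y. y \<in> Y \<Longrightarrow> \<exists>a\<in>A. mdist X y a < 2 * s"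
    using maximal_separated_subset[OF Y, of "2 * s"] s(2) by auto
  have AX: "A \<subseteq> mspace X" using A(1) Y by blast
  note ball = separated_in_ball_card[OF doubling s(1,2) A(1,2)]
  have "finite (A \<inter> mball_of X a (8 * s)) \<and> card (A \<inter> mball_of X a (8 * s)) \<le> N ^ 3" if "a \<in> A" for a
    using ball[of a 3] that AX by auto
  then obtain M where M: "A = (\<Union>i\<le>N ^ 3. M i)" "\<And>i. separated X (8 * s) (M i)"
    using separated_colouring[OF AX, of "8 * s" "N ^ 3"] s(2) by auto
  have "countable A"
  proof (cases "A = {}")
    case False
    then obtain a where a: "a \<in> A" by blast
    have "A \<subseteq> (\<Union>j. A \<inter> mball_of X a (2 ^ j * s))"
    proof
      fix x assume x: "x \<in> A"
      obtain j where "mdist X a x / s < 2 ^ j"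
        using real_arch_pow[of 2 "mdist X a x / s"] by auto
      then have "mdist X a x < 2 ^ j * s"
        using s(2) by (simp add: divide_less_eq)
      then show "x \<in> (\<Union>j. A \<inter> mball_of X a (2 ^ j * s))"
        using x a AX by auto
    qed
    moreover have "countable (\<Union>j. A \<inter> mball_of X a (2 ^ j * s))"
    proof (rule countable_UN)
      show "countable (A \<inter> mball_of X a (2 ^ j * s))" for j
        using ball[of a j] a AX by (intro countable_finite) auto
    qed simp
    ultimately show ?thesis by (rule countable_subset)
  qed simp
  define U where "U a = Y \<inter> mball_of X a (2 * s)" for a
  have near: "mdist X a u < 2 * s" "a \<in> mspace X" "u \<in> mspace X" if "u \<in> U a" for a u
    using that unfolding U_def by auto
  have "coloured_cover (N ^ 3) r (4 * s) (submetric X Y) (\<lambda>i. U ` M i)"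
    unfolding coloured_cover_def mspace_submetric mdist_submetric
  proof (intro conjI allI impI ballI)
    have "y \<in> (\<Union>a\<in>A. U a)" if "y \<in> Y" for y
      using A(3)[OF that] that AX Y unfolding U_def by (auto simp: mdist_commute[of X y])
    moreover have "U a \<subseteq> Y" for a unfolding U_def by blast
    ultimately have "Y = (\<Union>a\<in>A. U a)" by blast
    then show "Y \<inter> mspace X = (\<Union>i\<le>N ^ 3. \<Union>(U ` M i))"
      using Y unfolding M(1) by auto
  next
    fix i V x y assume "V \<in> U ` M i" "x \<in> V" "y \<in> V"
    then obtain a where a: "x \<in> U a" "y \<in> U a" by blast
    have "mdist X x y \<le> mdist X x a + mdist X a y"
      using near a by (intro mdist_triangle) blast+
    then show "mdist X x y \<le> 4 * s"
      using near(1)[OF a(1)] near(1)[OF a(2)] mdist_commute[of X x a] by linarith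
  next
    fix i V V' x y assume V: "V \<in> U ` M i" "V' \<in> U ` M i" "V \<noteq> V'" "x \<in> V" "y \<in> V'"
    then obtain a b where ab: "a \<in> M i" "b \<in> M i" "a \<noteq> b" "x \<in> U a" "y \<in> U b" by blast
    have "mdist X a b \<le> mdist X a x + mdist X x y + mdist X y b"
      using near ab(4,5) by (intro mdist_triangle3) blast+
    moreover have "8 * s \<le> mdist X a b"
      using M(2)[of i] ab(1-3) unfolding separated_def by blast
    ultimately show "r < mdist X x y"
      using near(1)[OF ab(4)] near(1)[OF ab(5)] mdist_commute[of X y b] s(2,3) by linarith
  next
    fix i :: nat assume "i \<le> N ^ 3"
    then have "M i \<subseteq> A" unfolding M(1) by blast
    then show "countable (U ` M i)"
      using \<open>countable A\<close> by (intro countable_image) (rule countable_subset)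
  qed
  then show ?thesis by (rule exI[of _ "\<lambda>i. U ` M i"])
qed

lemma large_scale_doubling_families_fdc: "large_scale_doubling_families X \<subseteq> fdc_families"
proof
  fix \<F> assume "\<F> \<in> large_scale_doubling_families X"
  then obtain \<Y> where \<F>: "\<F> = submetric X ` \<Y>" "metric_family (submetric X ` \<Y>)"
    and \<Y>: "\<Y> \<subseteq> Pow (mspace X)" and "large_scale_doubling X \<Y>"
    unfolding large_scale_doubling_families_def by (elim CollectE exE conjE)
  then obtain N R where doubling: "\<forall>Y\<in>\<Y>. large_scale_doubling_subset X N R Y"
    unfolding large_scale_doubling_def by (elim bexE exE conjE)
  show "\<F> \<in> fdc_families"
  proof (rule finite_asymptotic_dimension_fdc)
    show "metric_family \<F>" using \<F> by simp
  next
    fix r :: real assume r: "0 < r"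
    define s where "s = max r R"
    have s: "r \<le> s" "R \<le> s" "0 < s" using r unfolding s_def by auto
    have "\<exists>\<U>. coloured_cover (N ^ 3) r (4 * s) Z \<U>" if Z: "Z \<in> \<F>" for Z
    proof -
      obtain Y where Y: "Y \<in> \<Y>" "Z = submetric X Y" using Z \<F>(1) by blast
      then show ?thesis
        using doubling_coloured_cover[OF bspec[OF doubling Y(1)] _ s(2,3,1)] \<Y> by auto
    qed
    then show "\<exists>B\<ge>0. \<forall>Z\<in>\<F>. \<exists>\<U>. coloured_cover (N ^ 3) r B Z \<U>"
      using s(3) by (intro exI[of _ "4 * s"]) simp
  qed
qed

lemma fdc_families_subset_weak_fdc_families: "fdc_families \<subseteq> weak_fdc_families"
proof (rule fdc_families_least)
  show "closed_under_strong_decomposition weak_fdc_families"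
    using weak_fdc_families_closed
    unfolding closed_under_strong_decomposition_def closed_under_weak_decomposition_def
      strongly_decomposable_def weakly_decomposable_def by meson
qed (rule weak_fdc_families_metric_family, rule bounded_families_weak_fdc)

theorem corollary4p7:
  fixes X :: "'a metric"
  shows "(hyperbolic_dim X < \<infinity> \<longrightarrow> has_weak_fdc X) \<and>
         (hyperbolic_dim X \<le> 1 \<longrightarrow> has_fdc X)"
proof (intro conjI impI)
  have family: "metric_family {X}"
    unfolding metric_family_def by simp
  {
    assume "hyperbolic_dim X < \<infinity>"
    then obtain n where "hyperbolic_dim X = enat n"
      by (cases "hyperbolic_dim X") simp_all
    then have "hyperbolic_dim_at_most X n"
      using hyperbolic_dim_le_iff[of X n] by simp
    moreover have "large_scale_doubling_families X \<subseteq> weak_fdc_families"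
      using large_scale_doubling_families_fdc fdc_families_subset_weak_fdc_families by (rule subset_trans)
    ultimately have "n_decomposable n {X} weak_fdc_families"
      unfolding hyperbolic_dim_at_most_def by (rule n_decomposable_mono)
    then have "weakly_decomposable {X} weak_fdc_families"
      unfolding weakly_decomposable_def by (rule exI[of _ n])
    then show "has_weak_fdc X"
      using weak_fdc_families_closed[where 'a = 'a] family
      unfolding has_weak_fdc_def closed_under_weak_decomposition_def by simp
  next
    assume "hyperbolic_dim X \<le> 1"
    then have "hyperbolic_dim_at_most X 1"
      using hyperbolic_dim_le_iff[of X 1] by (simp add: one_enat_def)
    then have "strongly_decomposable {X} fdc_families"
      unfolding hyperbolic_dim_at_most_def strongly_decomposable_def
      using large_scale_doubling_families_fdc by (rule n_decomposable_mono)
    then show "has_fdc X"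
      using fdc_families_closed[where 'a = 'a] family
      unfolding has_fdc_def closed_under_strong_decomposition_def by simp
  }
qed

end
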